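(* Let $(\Omega,\rightarrow)$ be a finite (nonempty) associative semigroup of cardinality $\omega$, and let $p_n=\dim_{\mathbb{K}}(\mathbf{As}_\Omega^2(n))$. For any $n\geqslant 2$, $$p_n=\frac{\omega^n}{n-1}\left(\sum_{k=1}^{n-1}\binom{n-1}{k}\binom{n-1}{k-1}\omega^{n-1-k}(\omega-1)^{k-1}\right).$$
   Context: $\mathbb{K}$ is a commutative field; operads are operads in $\mathbb{K}$-vector spaces. For a semigroup $(\Omega,\rightarrow)$, $\mathbf{As}_\Omega^2$ is the nonsymmetric operad generated by binary operations $*_{\alpha,\beta}$ (linearly independent, $(\alpha,\beta)\in\Omega^2$) with the relations, for all $\alpha,\beta,\gamma\in\Omega$, $$*_{\alpha\rightarrow\beta,\gamma}\circ_1 *_{\alpha,\beta}=*_{\alpha,\beta\rightarrow\gamma}\circ_2 *_{\beta,\gamma}.$$ Convention: $0^0=1$ in the formula. *)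

theory Defs
  imports Complex_Main "HOL-Library.Tree" "HOL-Library.Poly_Mapping" "HOL-Library.Cardinality"
begin

section \<open>Nonsymmetric operads\<close>

text \<open>
  A nonsymmetric operad in vector spaces, given by its partial compositions. The components
  \<open>P n\<close> are subspaces of one ambient space, and \<open>comp x i y\<close> is
  \<open>x \<circ>\<^sub>i y\<close>, with inputs numbered from 1. Nothing is required of \<open>comp x i y\<close>
  when \<open>i\<close> is not an input of \<open>x\<close>, except that it is bilinear.
\<close>

locale ns_operad = vector_space scale
  for scale :: "'k::field \<Rightarrow> 'v::ab_group_add \<Rightarrow> 'v" +
  fixes P :: "nat \<Rightarrow> 'v set"
    and comp :: "'v \<Rightarrow> nat \<Rightarrow> 'v \<Rightarrow> 'v"
    and one :: 'v
  assumes subspace_P: "subspace (P n)"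
    and comp_add_left: "comp (x + x') i y = comp x i y + comp x' i y"
    and comp_add_right: "comp x i (y + y') = comp x i y + comp x i y'"
    and comp_scale_left: "comp (scale c x) i y = scale c (comp x i y)"
    and comp_scale_right: "comp x i (scale c y) = scale c (comp x i y)"
    and one_in: "one \<in> P 1"
    and comp_in: "x \<in> P m \<Longrightarrow> y \<in> P n \<Longrightarrow> 1 \<le> i \<Longrightarrow> i \<le> m \<Longrightarrow> comp x i y \<in> P (m + n - 1)"
    and one_comp: "x \<in> P m \<Longrightarrow> comp one 1 x = x"
    and comp_one: "x \<in> P m \<Longrightarrow> 1 \<le> i \<Longrightarrow> i \<le> m \<Longrightarrow> comp x i one = x"
    and comp_sequential: "x \<in> P l \<Longrightarrow> y \<in> P m \<Longrightarrow> z \<in> P n \<Longrightarrow> 1 \<le> i \<Longrightarrow> i \<le> l \<Longrightarrow>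
      1 \<le> j \<Longrightarrow> j \<le> m \<Longrightarrow> comp (comp x i y) (i - 1 + j) z = comp x i (comp y j z)"
    and comp_parallel: "x \<in> P l \<Longrightarrow> y \<in> P m \<Longrightarrow> z \<in> P n \<Longrightarrow> 1 \<le> i \<Longrightarrow> i < k \<Longrightarrow> k \<le> l \<Longrightarrow>
      comp (comp x i y) (k - 1 + m) z = comp (comp x k z) i y"

section \<open>The free nonsymmetric operad on a set of binary generators\<close>

text \<open>
  A basis of the free operad generated by binary operations indexed by \<open>'e\<close> is given by the
  planar binary trees with inner nodes labelled by \<open>'e\<close>. The inputs of a tree are its leaves,
  so that its arity is \<^const>\<open>size1\<close>; the operad is the space of finitely supported functions
  on these trees.
\<close>

text \<open>\<open>graft s i t\<close> replaces the \<open>i\<close>-th leaf of \<open>s\<close>, counted from the left, by \<open>t\<close>.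
  It is only meaningful for \<open>1 \<le> i \<le> size1 s\<close>.\<close>

fun graft :: "'e tree \<Rightarrow> nat \<Rightarrow> 'e tree \<Rightarrow> 'e tree" where
  "graft Leaf i t = t"
| "graft (Node l a r) i t =
    (if i \<le> size1 l then Node (graft l i t) a r else Node l a (graft r (i - size1 l) t))"

definition free_scale :: "'k::field \<Rightarrow> ('e tree \<Rightarrow>\<^sub>0 'k) \<Rightarrow> ('e tree \<Rightarrow>\<^sub>0 'k)" where
  "free_scale c p = Poly_Mapping.map ((*) c) p"

definition free_arity :: "nat \<Rightarrow> ('e tree \<Rightarrow>\<^sub>0 'k::field) set" where
  "free_arity n = {p. \<forall>t\<in>Poly_Mapping.keys p. size1 t = n}"

text \<open>The bilinear extension of grafting. A tree in \<open>p\<close> that has no \<open>i\<close>-th leaf contributes 0.\<close>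

definition free_comp ::
    "('e tree \<Rightarrow>\<^sub>0 'k::field) \<Rightarrow> nat \<Rightarrow> ('e tree \<Rightarrow>\<^sub>0 'k) \<Rightarrow> ('e tree \<Rightarrow>\<^sub>0 'k)" where
  "free_comp p i q =
    (\<Sum>s\<in>{s \<in> Poly_Mapping.keys p. 1 \<le> i \<and> i \<le> size1 s}. \<Sum>t\<in>Poly_Mapping.keys q.
      Poly_Mapping.single (graft s i t) (Poly_Mapping.lookup p s * Poly_Mapping.lookup q t))"

definition free_one :: "'e tree \<Rightarrow>\<^sub>0 'k::field" where
  "free_one = Poly_Mapping.single Leaf 1"

definition free_gen :: "'e \<Rightarrow> ('e tree \<Rightarrow>\<^sub>0 'k::field)" where
  "free_gen a = Poly_Mapping.single (Node Leaf a Leaf) 1"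

text \<open>The operadic ideal generated by a set of relators. For homogeneous relators it is
  the direct sum of its components in each arity, since out-of-range compositions vanish.\<close>

inductive_set operad_ideal :: "('e tree \<Rightarrow>\<^sub>0 'k::field) set \<Rightarrow> ('e tree \<Rightarrow>\<^sub>0 'k) set"
  for R :: "('e tree \<Rightarrow>\<^sub>0 'k) set" where
  zero: "0 \<in> operad_ideal R"
| relator: "x \<in> R \<Longrightarrow> x \<in> operad_ideal R"
| add: "x \<in> operad_ideal R \<Longrightarrow> y \<in> operad_ideal R \<Longrightarrow> x + y \<in> operad_ideal R"
| scale: "x \<in> operad_ideal R \<Longrightarrow> free_scale c x \<in> operad_ideal R"
| comp_left: "x \<in> operad_ideal R \<Longrightarrow> free_comp x i y \<in> operad_ideal R"
| comp_right: "x \<in> operad_ideal R \<Longrightarrow> free_comp y i x \<in> operad_ideal R"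


subsection \<open>The free operad is an operad\<close>

lemma lookup_free_scale [simp]:
  "Poly_Mapping.lookup (free_scale c p) t = c * Poly_Mapping.lookup p t"
  by (simp add: free_scale_def Poly_Mapping.map.rep_eq when_def)

interpretation free: vector_space "free_scale :: 'k::field \<Rightarrow> ('e tree \<Rightarrow>\<^sub>0 'k) \<Rightarrow> _"
  by standard (rule poly_mapping_eqI; simp add: lookup_add algebra_simps)+

lemma free_scale_single [simp]:
  "free_scale c (Poly_Mapping.single t d) = Poly_Mapping.single t (c * d)"
  by (rule poly_mapping_eqI) (simp add: lookup_single when_def)

lemma free_comp_superset:
  assumes "finite A" "finite B" "Poly_Mapping.keys p \<subseteq> A" "Poly_Mapping.keys q \<subseteq> B"
  shows "free_comp p i q = (\<Sum>s\<in>A. \<Sum>t\<in>B. if 1 \<le> i \<and> i \<le> size1 s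
      then Poly_Mapping.single (graft s i t) (Poly_Mapping.lookup p s * Poly_Mapping.lookup q t)
      else 0)" (is "_ = (\<Sum>s\<in>A. \<Sum>t\<in>B. ?f s t)")
proof -
  have "free_comp p i q = (\<Sum>s\<in>Poly_Mapping.keys p. \<Sum>t\<in>Poly_Mapping.keys q. ?f s t)"
    unfolding free_comp_def
    by (rule sum.mono_neutral_cong_left) (auto intro!: sum.neutral split: if_splits)
  also have "\<dots> = (\<Sum>s\<in>Poly_Mapping.keys p. \<Sum>t\<in>B. ?f s t)"
    using assms by (intro sum.cong refl sum.mono_neutral_left) (auto simp: in_keys_iff)
  also have "\<dots> = (\<Sum>s\<in>A. \<Sum>t\<in>B. ?f s t)"
    using assms by (intro sum.mono_neutral_left) (auto simp: in_keys_iff intro!: sum.neutral)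
  finally show ?thesis .
qed

lemma free_comp_single [simp]:
  "free_comp (Poly_Mapping.single s c) i (Poly_Mapping.single t d) =
    (if 1 \<le> i \<and> i \<le> size1 s then Poly_Mapping.single (graft s i t) (c * d) else 0)"
  by (subst free_comp_superset[of "{s}" "{t}"]) auto

lemma free_comp_add_left: "free_comp (p + p') i q = free_comp p i q + free_comp p' i q"
proof -
  let ?A = "Poly_Mapping.keys p \<union> Poly_Mapping.keys p'" and ?B = "Poly_Mapping.keys q"
  have *: "Poly_Mapping.keys (p + p') \<subseteq> ?A"
    by (rule keys_add)
  show ?thesis
    by (subst (1 2 3) free_comp_superset[of ?A ?B])
      (use * in \<open>auto simp flip: sum.distrib simp: lookup_add distrib_right single_add
        intro!: sum.cong\<close>)
qed

lemma free_comp_add_right: "free_comp p i (q + q') = free_comp p i q + free_comp p i q'"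
proof -
  let ?A = "Poly_Mapping.keys p" and ?B = "Poly_Mapping.keys q \<union> Poly_Mapping.keys q'"
  have *: "Poly_Mapping.keys (q + q') \<subseteq> ?B"
    by (rule keys_add)
  show ?thesis
    by (subst (1 2 3) free_comp_superset[of ?A ?B])
      (use * in \<open>auto simp flip: sum.distrib simp: lookup_add distrib_left single_add
        intro!: sum.cong\<close>)
qed

lemma free_comp_scale_left: "free_comp (free_scale c p) i q = free_scale c (free_comp p i q)"
proof -
  have *: "Poly_Mapping.keys (free_scale c p) \<subseteq> Poly_Mapping.keys p"
    by (auto simp: in_keys_iff)
  show ?thesis
    by (subst (1 2) free_comp_superset[of "Poly_Mapping.keys p" "Poly_Mapping.keys q"])
      (use * in \<open>auto simp: free.scale_sum_right mult.assoc intro!: sum.cong\<close>)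
qed

lemma free_comp_scale_right: "free_comp p i (free_scale c q) = free_scale c (free_comp p i q)"
proof -
  have *: "Poly_Mapping.keys (free_scale c q) \<subseteq> Poly_Mapping.keys q"
    by (auto simp: in_keys_iff)
  show ?thesis
    by (subst (1 2) free_comp_superset[of "Poly_Mapping.keys p" "Poly_Mapping.keys q"])
      (use * in \<open>auto simp: free.scale_sum_right mult.left_commute intro!: sum.cong\<close>)
qed

lemma free_comp_minus_left: "free_comp (p - p') i q = free_comp p i q - free_comp p' i q"
  by (metis add_diff_cancel_right' diff_add_cancel free_comp_add_left)

lemma free_comp_minus_right: "free_comp p i (q - q') = free_comp p i q - free_comp p i q'"
  by (metis add_diff_cancel_right' diff_add_cancel free_comp_add_right)

lemma subspace_free_arity: "free.subspace (free_arity n :: ('e tree \<Rightarrow>\<^sub>0 'k::field) set)"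
  unfolding free.subspace_def free_arity_def
  by (auto simp: in_keys_iff lookup_add; metis add_0)

lemma free_arity_induct [consumes 1, case_names zero single add]:
  assumes "p \<in> free_arity n"
    and "Q 0"
    and "\<And>t c. size1 t = n \<Longrightarrow> Q (Poly_Mapping.single t c)"
    and "\<And>p q. Q p \<Longrightarrow> Q q \<Longrightarrow> Q (p + q)"
  shows "Q p"
proof -
  have p: "p = (\<Sum>t\<in>Poly_Mapping.keys p. Poly_Mapping.single t (Poly_Mapping.lookup p t))"
    by (rule poly_mapping_eqI)
      (simp add: lookup_sum lookup_single when_def in_keys_iff)
  have "Q (\<Sum>t\<in>A. Poly_Mapping.single t (Poly_Mapping.lookup p t))"
    if "finite A" "A \<subseteq> Poly_Mapping.keys p" for A
    using that by induction (use assms in \<open>auto simp: free_arity_def\<close>)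
  then show ?thesis
    by (subst p) simp
qed

lemma size1_graft: "1 \<le> i \<Longrightarrow> i \<le> size1 s \<Longrightarrow> size1 (graft s i t) = size1 s + size1 t - 1"
proof (induction s i t rule: graft.induct)
  case (2 l a r i t)
  then show ?case
    using size1_ge0[of l] size1_ge0[of r] by (auto simp del: size1_ge0)
qed simp

lemma graft_Leaf: "1 \<le> i \<Longrightarrow> i \<le> size1 s \<Longrightarrow> graft s i Leaf = s"
  by (induction s arbitrary: i) auto

lemma graft_sequential:
  "1 \<le> i \<Longrightarrow> i \<le> size1 s \<Longrightarrow> 1 \<le> j \<Longrightarrow> j \<le> size1 t \<Longrightarrow>
    graft (graft s i t) (i - 1 + j) u = graft s i (graft t j u)"
proof (induction s arbitrary: i)
  case Leaf
  then show ?case by simp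
next
  case (Node l a r)
  show ?case
  proof (cases "i \<le> size1 l")
    case True
    then have "i - 1 + j \<le> size1 l + size1 t - 1"
      using Node.prems by linarith
    with True show ?thesis
      using Node.IH(1)[of i] Node.prems by (simp add: size1_graft)
  next
    case False
    then have "i - 1 + j - size1 l = (i - size1 l) - 1 + j" "\<not> i - 1 + j \<le> size1 l"
      "1 \<le> i - size1 l" "i - size1 l \<le> size1 r"
      using Node.prems False unfolding size1.simps by linarith+
    with False show ?thesis
      using Node.IH(2)[of "i - size1 l"] Node.prems by simp
  qed
qed

lemma graft_parallel:
  "1 \<le> i \<Longrightarrow> i < k \<Longrightarrow> k \<le> size1 s \<Longrightarrow>
    graft (graft s i t) (k - 1 + size1 t) u = graft (graft s k u) i t"
proof (induction s arbitrary: i k)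
  case Leaf
  then show ?case by simp
next
  case (Node l a r)
  consider "k \<le> size1 l" | "i \<le> size1 l" "size1 l < k" | "size1 l < i"
    by linarith
  then show ?case
  proof cases
    case 1
    then have "k - 1 + size1 t \<le> size1 l + size1 t - 1" "i \<le> size1 l + size1 u - 1"
      using Node.prems size1_ge0[of u] by linarith+
    with 1 show ?thesis
      using Node.IH(1)[of i k] Node.prems
      by (simp add: size1_graft)
  next
    case 2
    then have "k - 1 + size1 t - (size1 l + size1 t - 1) = k - size1 l"
      "\<not> k - 1 + size1 t \<le> size1 l + size1 t - 1"
      using Node.prems size1_ge0[of l] by linarith+
    with 2 show ?thesis
      using Node.prems by (simp add: size1_graft)
  next
    case 3
    then have "k - 1 + size1 t - size1 l = (k - size1 l) - 1 + size1 t"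
      "\<not> k - 1 + size1 t \<le> size1 l"
      using Node.prems size1_ge0[of t] by linarith+
    with 3 show ?thesis
      using Node.IH(2)[of "i - size1 l" "k - size1 l"] Node.prems by simp
  qed
qed

lemma free_comp_zero [simp]: "free_comp 0 i q = 0" "free_comp p i 0 = 0"
  by (simp_all add: free_comp_def)

lemma free_single_in_arity: "size1 t = n \<Longrightarrow> Poly_Mapping.single t c \<in> free_arity n"
  by (simp add: free_arity_def)

lemma free_comp_in:
  assumes "x \<in> free_arity m" "y \<in> free_arity n" "1 \<le> i" "i \<le> m"
  shows "free_comp x i y \<in> free_arity (m + n - 1)"
  using assms(1)
proof (induction rule: free_arity_induct)
  case (single s c)
  show ?case using assms(2)
  proof (induction rule: free_arity_induct)
    case zero
    then show ?case by (simp add: free.subspace_0[OF subspace_free_arity])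
  next
    case (single t d)
    then show ?case
      using \<open>size1 s = m\<close> assms by (simp add: free_single_in_arity size1_graft)
  next
    case (add p q)
    then show ?case
      by (simp add: free_comp_add_right free.subspace_add[OF subspace_free_arity])
  qed
qed (simp_all add: free_comp_add_left free.subspace_0[OF subspace_free_arity]
      free.subspace_add[OF subspace_free_arity])

lemma free_one_comp: "x \<in> free_arity m \<Longrightarrow> free_comp free_one 1 x = x"
  by (induction rule: free_arity_induct) (simp_all add: free_one_def free_comp_add_right)

lemma free_comp_one: "x \<in> free_arity m \<Longrightarrow> 1 \<le> i \<Longrightarrow> i \<le> m \<Longrightarrow> free_comp x i free_one = x"
  by (induction rule: free_arity_induct)
    (simp_all add: free_one_def free_comp_add_left graft_Leaf)

lemma free_comp_sequential:
  assumes "x \<in> free_arity l" "y \<in> free_arity m" "z \<in> free_arity n"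
    "1 \<le> i" "i \<le> l" "1 \<le> j" "j \<le> m"
  shows "free_comp (free_comp x i y) (i - 1 + j) z = free_comp x i (free_comp y j z)"
  using assms(1)
proof (induction rule: free_arity_induct)
  case (single s c)
  note s = this
  show ?case using assms(2)
  proof (induction rule: free_arity_induct)
    case (single t d)
    note t = this
    show ?case using assms(3)
    proof (induction rule: free_arity_induct)
      case (single u e)
      have "1 \<le> i - 1 + j" "i - 1 + j \<le> size1 s + size1 t - 1"
        using assms s t by linarith+
      then show ?case
        using assms s t graft_sequential[of i s j t u] by (simp add: size1_graft mult.assoc)
    qed (simp_all add: free_comp_add_right)
  qed (simp_all add: free_comp_add_right free_comp_add_left)
qed (simp_all add: free_comp_add_left)

lemma free_comp_parallel:
  assumes "x \<in> free_arity l" "y \<in> free_arity m" "z \<in> free_arity n"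
    "1 \<le> i" "i < k" "k \<le> l"
  shows "free_comp (free_comp x i y) (k - 1 + m) z = free_comp (free_comp x k z) i y"
  using assms(1)
proof (induction rule: free_arity_induct)
  case (single s c)
  note s = this
  show ?case using assms(2)
  proof (induction rule: free_arity_induct)
    case (single t d)
    note t = this
    show ?case using assms(3)
    proof (induction rule: free_arity_induct)
      case (single u e)
      have "1 \<le> k - 1 + m" "k - 1 + m \<le> size1 s + size1 t - 1" "i \<le> size1 s + size1 u - 1"
        using assms s t size1_ge0[of u] by linarith+
      then show ?case
        using assms s t graft_parallel[of i k s t u]
        by (simp add: size1_graft mult.assoc mult.commute[of d e])
    qed (simp_all add: free_comp_add_right free_comp_add_left)
  qed (simp_all add: free_comp_add_right free_comp_add_left)
qed (simp_all add: free_comp_add_left)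

interpretation free: ns_operad "free_scale :: 'k::field \<Rightarrow> ('e tree \<Rightarrow>\<^sub>0 'k) \<Rightarrow> _"
    free_arity free_comp free_one
  by unfold_locales
    (fact subspace_free_arity free_comp_add_left free_comp_add_right free_comp_scale_left
      free_comp_scale_right free_comp_in free_one_comp free_comp_one free_comp_sequential
      free_comp_parallel | simp add: free_single_in_arity free_one_def)+


section \<open>The operad \<open>As\<^sup>2\<^sub>\<Omega>\<close>\<close>

text \<open>
  The semigroup \<open>\<Omega>\<close> is a type of class \<^class>\<open>semigroup_mult\<close>, whose product is written
  \<open>\<alpha> * \<beta>\<close> here. The generator with index \<open>(\<alpha>, \<beta>)\<close> is the operation
  \<open>*\<^bsub>\<alpha>,\<beta>\<^esub>\<close>.
\<close>

definition as2_relators :: "(('w::semigroup_mult \<times> 'w) tree \<Rightarrow>\<^sub>0 'k::field) set" where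
  "as2_relators =
    {free_comp (free_gen (\<alpha> * \<beta>, \<gamma>)) 1 (free_gen (\<alpha>, \<beta>)) -
     free_comp (free_gen (\<alpha>, \<beta> * \<gamma>)) 2 (free_gen (\<beta>, \<gamma>)) | \<alpha> \<beta> \<gamma>. True}"

definition as2_rel ::
    "(('w::semigroup_mult \<times> 'w) tree \<Rightarrow>\<^sub>0 'k::field) \<Rightarrow> (('w \<times> 'w) tree \<Rightarrow>\<^sub>0 'k) \<Rightarrow> bool" where
  "as2_rel p q \<longleftrightarrow> p - q \<in> operad_ideal as2_relators"

lemma operad_ideal_uminus: "x \<in> operad_ideal R \<Longrightarrow> - x \<in> operad_ideal R"
  using operad_ideal.scale[of x R "-1"] by simp

lemma operad_ideal_diff:
  "x \<in> operad_ideal R \<Longrightarrow> y \<in> operad_ideal R \<Longrightarrow> x - y \<in> operad_ideal R"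
  using operad_ideal.add[OF _ operad_ideal_uminus, of x R y] by simp

quotient_type (overloaded) ('w, 'k) as2 = "('w::semigroup_mult \<times> 'w) tree \<Rightarrow>\<^sub>0 'k::field" / as2_rel
proof (rule equivpI)
  show "reflp as2_rel"
    by (simp add: reflp_def as2_rel_def operad_ideal.zero)
  show "symp as2_rel"
    unfolding symp_def as2_rel_def by (metis minus_diff_eq operad_ideal_uminus)
  show "transp as2_rel"
    unfolding transp_def as2_rel_def by (auto dest: operad_ideal.add)
qed

instantiation as2 :: (semigroup_mult, field) ab_group_add
begin

lift_definition zero_as2 :: "('a, 'b) as2" is 0 .

lift_definition plus_as2 :: "('a, 'b) as2 \<Rightarrow> ('a, 'b) as2 \<Rightarrow> ('a, 'b) as2" is "(+)"
  unfolding as2_rel_def by (simp add: add_diff_add operad_ideal.add)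

lift_definition uminus_as2 :: "('a, 'b) as2 \<Rightarrow> ('a, 'b) as2" is uminus
  unfolding as2_rel_def by (auto dest: operad_ideal_uminus)

lift_definition minus_as2 :: "('a, 'b) as2 \<Rightarrow> ('a, 'b) as2 \<Rightarrow> ('a, 'b) as2" is "(-)"
  unfolding as2_rel_def by (auto dest: operad_ideal_diff simp: algebra_simps)

instance
  by standard (transfer; simp add: as2_rel_def operad_ideal.zero algebra_simps)+

end

lift_definition as2_scale :: "'k::field \<Rightarrow> ('w::semigroup_mult, 'k) as2 \<Rightarrow> ('w, 'k) as2"
  is free_scale
  unfolding as2_rel_def by (simp add: operad_ideal.scale flip: free.scale_right_diff_distrib)

lift_definition as2_comp ::
    "('w::semigroup_mult, 'k::field) as2 \<Rightarrow> nat \<Rightarrow> ('w, 'k) as2 \<Rightarrow> ('w, 'k) as2"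
  is free_comp
proof -
  fix p p' q q' :: "('w \<times> 'w) tree \<Rightarrow>\<^sub>0 'k" and i :: nat
  assume "as2_rel p p'" "as2_rel q q'"
  then have "free_comp (p - p') i q + free_comp p' i (q - q') \<in> operad_ideal as2_relators"
    unfolding as2_rel_def by (intro operad_ideal.add operad_ideal.comp_left operad_ideal.comp_right)
  then show "as2_rel (free_comp p i q) (free_comp p' i q')"
    by (simp add: as2_rel_def free_comp_minus_left free_comp_minus_right)
qed

lift_definition as2_one :: "('w::semigroup_mult, 'k::field) as2" is free_one .

text \<open>The operation \<open>*\<^bsub>\<alpha>,\<beta>\<^esub>\<close> in \<open>As\<^sup>2\<^sub>\<Omega>\<close>.\<close>

lift_definition as2_gen :: "'w::semigroup_mult \<Rightarrow> 'w \<Rightarrow> ('w, 'k::field) as2"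
  is "\<lambda>\<alpha> \<beta>. free_gen (\<alpha>, \<beta>)" .

definition as2_arity :: "nat \<Rightarrow> ('w::semigroup_mult, 'k::field) as2 set" where
  "as2_arity n = abs_as2 ` free_arity n"

interpretation as2: vector_space
    "as2_scale :: 'k::field \<Rightarrow> ('w::semigroup_mult, 'k) as2 \<Rightarrow> _"
  by standard
    (transfer; simp add: as2_rel_def operad_ideal.zero free.scale_right_distrib
      free.scale_left_distrib)+

lemma subspace_as2_arity: "as2.subspace (as2_arity n :: ('w::semigroup_mult, 'k::field) as2 set)"
proof -
  have "module_hom free_scale as2_scale (abs_as2 :: _ \<Rightarrow> ('w, 'k) as2)"
    by unfold_locales (simp_all add: plus_as2.abs_eq as2_scale.abs_eq)
  then show ?thesis
    unfolding as2_arity_def using module_hom.subspace_image subspace_free_arity by blast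
qed

interpretation as2: ns_operad "as2_scale :: 'k::field \<Rightarrow> ('w::semigroup_mult, 'k) as2 \<Rightarrow> _"
    as2_arity as2_comp as2_one
proof
  show "as2.subspace (as2_arity n :: ('w, 'k) as2 set)" for n
    by (rule subspace_as2_arity)
next
  fix x y z :: "('w, 'k) as2" and l m n i j :: nat
  assume "x \<in> as2_arity l" "y \<in> as2_arity m" "z \<in> as2_arity n"
    "1 \<le> i" "i \<le> l" "1 \<le> j" "j \<le> m"
  then show "as2_comp (as2_comp x i y) (i - 1 + j) z = as2_comp x i (as2_comp y j z)"
    unfolding as2_arity_def
    by (clarify, simp only: as2_comp.abs_eq free.comp_sequential)
next
  fix x y z :: "('w, 'k) as2" and l m n i k :: nat
  assume "x \<in> as2_arity l" "y \<in> as2_arity m" "z \<in> as2_arity n" "1 \<le> i" "i < k" "k \<le> l"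
  then show "as2_comp (as2_comp x i y) (k - 1 + m) z = as2_comp (as2_comp x k z) i y"
    unfolding as2_arity_def
    by (clarify, simp only: as2_comp.abs_eq free.comp_parallel)
next
  fix x x' y y' :: "('w, 'k) as2" and i :: nat and c :: 'k
  show "as2_comp (x + x') i y = as2_comp x i y + as2_comp x' i y"
    "as2_comp x i (y + y') = as2_comp x i y + as2_comp x i y'"
    "as2_comp (as2_scale c x) i y = as2_scale c (as2_comp x i y)"
    "as2_comp x i (as2_scale c y) = as2_scale c (as2_comp x i y)"
    by (transfer; simp add: as2_rel_def operad_ideal.zero free_comp_add_left free_comp_add_right
        free_comp_scale_left free_comp_scale_right)+
qed (auto simp: as2_arity_def as2_one_def as2_comp.abs_eq free.one_in free.comp_in free.one_comp
      free.comp_one simp del: One_nat_def)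

lemma as2_gen_in_arity: "as2_gen \<alpha> \<beta> \<in> as2_arity 2"
  by (auto simp: as2_gen_def as2_arity_def free_gen_def intro!: imageI free_single_in_arity)

lemma as2_relation:
  "as2_comp (as2_gen (\<alpha> * \<beta>) \<gamma>) 1 (as2_gen \<alpha> \<beta>) =
   as2_comp (as2_gen \<alpha> (\<beta> * \<gamma>)) 2 (as2_gen \<beta> \<gamma> :: ('w::semigroup_mult, 'k::field) as2)"
  by transfer (auto simp: as2_rel_def as2_relators_def intro!: operad_ideal.relator)

end

theory Submission
  imports Defs "HOL-Computational_Algebra.Formal_Power_Series"
begin

text \<open>
  Orient the relations from left to right, as rotations of labelled trees. Since the product is
  associative, the only critical pair is confluent, so the trees without a left edge from a node
  labelled \<open>(\<alpha>, \<beta>)\<close> up to a node labelled \<open>(\<alpha> * \<beta>, \<gamma>)\<close> form a basis. Labelling a tree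
  from the leaves to the root, a node has \<open>\<omega> (\<omega> - 1)\<close> admissible labels if it has a left child
  and \<open>\<omega>\<^sup>2\<close> otherwise, whatever the product is. So the generating function \<open>A\<close> of normal trees by
  number of nodes satisfies \<open>A = 1 + X (\<omega> A + \<omega> (\<omega> - 1) A\<^sup>2)\<close>, and the coefficients of all its
  powers follow from the recurrence obtained by multiplying this equation with \<open>A ^ r\<close>.
\<close>

section \<open>Rewriting trees to normal form\<close>

text \<open>Reflexive, transitive closure of the oriented relations, under contexts. Both children
  may be rewritten at once, and reflexivity covers the case that only one of them changes.\<close>

inductive rewrites_to :: "('w::semigroup_mult \<times> 'w) tree \<Rightarrow> ('w \<times> 'w) tree \<Rightarrow> bool"
    (infix "\<leadsto>" 50) where
  rewrites_refl: "t \<leadsto> t"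
| rewrites_rotate: "Node (Node t (\<alpha>, \<beta>) u) (\<alpha> * \<beta>, \<gamma>) v \<leadsto> Node t (\<alpha>, \<beta> * \<gamma>) (Node u (\<beta>, \<gamma>) v)"
| rewrites_Node: "l \<leadsto> l' \<Longrightarrow> r \<leadsto> r' \<Longrightarrow> Node l a r \<leadsto> Node l' a r'"
| rewrites_trans [trans]: "s \<leadsto> t \<Longrightarrow> t \<leadsto> u \<Longrightarrow> s \<leadsto> u"

fun left_irreducible :: "('w::semigroup_mult \<times> 'w) tree \<Rightarrow> 'w \<times> 'w \<Rightarrow> bool" where
  "left_irreducible Leaf a \<longleftrightarrow> True"
| "left_irreducible (Node l b r) a \<longleftrightarrow> fst a \<noteq> fst b * snd b"

fun normal :: "('w::semigroup_mult \<times> 'w) tree \<Rightarrow> bool" where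
  "normal Leaf \<longleftrightarrow> True"
| "normal (Node l a r) \<longleftrightarrow> left_irreducible l a \<and> normal l \<and> normal r"

text \<open>Normalises \<open>Node l a r\<close> for normal \<open>l\<close> and \<open>r\<close>.
  After a rotation at the root the only possible new redex sits at the new right child, so the
  recursion descends into \<open>m\<close>.\<close>

fun join :: "('w::semigroup_mult \<times> 'w) tree \<Rightarrow> 'w \<times> 'w \<Rightarrow> ('w \<times> 'w) tree \<Rightarrow> ('w \<times> 'w) tree" where
  "join Leaf a r = Node Leaf a r"
| "join (Node l b m) a r =
    (if fst a = fst b * snd b then Node l (fst b, snd b * snd a) (join m (snd b, snd a) r)
     else Node (Node l b m) a r)"

fun nf :: "('w::semigroup_mult \<times> 'w) tree \<Rightarrow> ('w \<times> 'w) tree" where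
  "nf Leaf = Leaf"
| "nf (Node l a r) = join (nf l) a (nf r)"

lemma join_irreducible: "left_irreducible l a \<Longrightarrow> join l a r = Node l a r"
  by (cases l) auto

text \<open>A rotation alters only the second component of the label that ends up above
  \<open>l\<close>, while \<open>left_irreducible\<close> looks only at the first.\<close>

lemma normal_join:
  assumes "normal l" "normal r"
  shows "normal (join l a r)"
proof -
  have "left_irreducible l (c, x) \<longleftrightarrow> left_irreducible l (c, y)" for l and c x y :: 'a
    by (cases l) auto
  then show ?thesis
    using assms by (induction l a r rule: join.induct) (auto, metis prod.collapse)
qed

lemma normal_nf: "normal (nf t)"
  by (induction t) (auto simp: normal_join)

lemma nf_normal: "normal t \<Longrightarrow> nf t = t"
  by (induction t) (auto simp: join_irreducible)

text \<open>This is the confluence of the only critical pair of the rewriting system.\<close>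

lemma join_assoc:
  "join (join t (\<alpha>, \<beta>) u) (\<alpha> * \<beta>, \<gamma>) v = join t (\<alpha>, \<beta> * \<gamma>) (join u (\<beta>, \<gamma>) v)"
  by (induction t arbitrary: \<alpha> \<beta>) (auto simp: mult.assoc)

lemma rewrites_nf_eq: "s \<leadsto> t \<Longrightarrow> nf s = nf t"
  by (induction rule: rewrites_to.induct) (auto simp: join_assoc)

lemma rewrites_size1: "s \<leadsto> t \<Longrightarrow> size1 s = size1 t"
  by (induction rule: rewrites_to.induct) auto

lemma rewrites_join: "Node l a r \<leadsto> join l a r"
proof (induction l a r rule: join.induct)
  case (2 l b m a r)
  show ?case
  proof (cases "fst a = fst b * snd b")
    case True
    then have "Node (Node l b m) a r \<leadsto> Node l (fst b, snd b * snd a) (Node m (snd b, snd a) r)"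
      using rewrites_rotate[of l "fst b" "snd b" m "snd a" r] by (metis prod.collapse)
    also have "\<dots> \<leadsto> Node l (fst b, snd b * snd a) (join m (snd b, snd a) r)"
      using 2 True by (intro rewrites_Node rewrites_refl)
    finally show ?thesis
      using True by simp
  qed (simp add: rewrites_refl)
qed (simp add: rewrites_refl)

lemma rewrites_nf: "t \<leadsto> nf t"
proof (induction t)
  case (Node l a r)
  then have "Node l a r \<leadsto> Node (nf l) a (nf r)"
    by (rule rewrites_Node)
  also have "\<dots> \<leadsto> nf (Node l a r)"
    by (simp add: rewrites_join)
  finally show ?case .
qed (simp add: rewrites_refl)

lemma size1_nf [simp]: "size1 (nf t) = size1 t"
  using rewrites_size1[OF rewrites_nf] by metis

section \<open>Compatibility of normal forms with grafting\<close>

lemma rewrites_graft: "s \<leadsto> s' \<Longrightarrow> graft s i t \<leadsto> graft s' i t"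
proof (induction arbitrary: i rule: rewrites_to.induct)
  case (rewrites_rotate s \<alpha> \<beta> u \<gamma> v)
  \<comment> \<open>The rotation keeps the three subtrees in their order from left to right, so both
    sides graft into the same one.\<close>
  consider "i \<le> size1 s" | "size1 s < i" "i \<le> size1 s + size1 u" | "size1 s + size1 u < i"
    by linarith
  then show ?case
    by cases (auto simp: diff_diff_left intro: rewrites_to.rewrites_rotate)
next
  case (rewrites_Node l l' r r' a)
  then show ?case
    by (auto simp: rewrites_size1 intro: rewrites_to.rewrites_Node)
next
  case (rewrites_trans s t u)
  then show ?case
    by (metis rewrites_to.rewrites_trans)
qed (rule rewrites_refl)

lemma nf_graft_nf_left: "nf (graft (nf s) i t) = nf (graft s i t)"
  using rewrites_nf_eq[OF rewrites_graft[OF rewrites_nf]] by metis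

text \<open>The grafted tree is a subtree of the result and \<open>nf\<close> works from the leaves
  upwards, so only idempotence of \<open>nf\<close> is needed.\<close>

lemma nf_graft_nf_right: "nf (graft s i (nf t)) = nf (graft s i t)"
  by (induction s arbitrary: i) (auto simp: nf_normal normal_nf)

section \<open>A basis of the operad\<close>

definition linear_nf :: "(('w::semigroup_mult \<times> 'w) tree \<Rightarrow>\<^sub>0 'k::field) \<Rightarrow> (('w \<times> 'w) tree \<Rightarrow>\<^sub>0 'k)" where
  "linear_nf p = (\<Sum>t\<in>Poly_Mapping.keys p. Poly_Mapping.single (nf t) (Poly_Mapping.lookup p t))"

lemma linear_nf_superset:
  assumes "finite A" "Poly_Mapping.keys p \<subseteq> A"
  shows "linear_nf p = (\<Sum>t\<in>A. Poly_Mapping.single (nf t) (Poly_Mapping.lookup p t))"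
  unfolding linear_nf_def using assms by (intro sum.mono_neutral_left) (auto simp: in_keys_iff)

lemma linear_nf_add: "linear_nf (p + q) = linear_nf p + linear_nf q"
  using keys_add[of p q]
  by (subst (1 2 3) linear_nf_superset[of "Poly_Mapping.keys p \<union> Poly_Mapping.keys q"])
    (auto simp: lookup_add single_add sum.distrib)

lemma linear_nf_single [simp]: "linear_nf (Poly_Mapping.single t c) = Poly_Mapping.single (nf t) c"
  by (subst linear_nf_superset[of "{t}"]) auto

lemma linear_nf_zero [simp]: "linear_nf 0 = 0"
  by (simp add: linear_nf_def)

lemma linear_nf_diff: "linear_nf (p - q) = linear_nf p - linear_nf q"
  by (metis add_diff_cancel_right' diff_add_cancel linear_nf_add)

lemma linear_nf_scale: "linear_nf (free_scale c p) = free_scale c (linear_nf p)"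
proof -
  have "Poly_Mapping.keys (free_scale c p) \<subseteq> Poly_Mapping.keys p"
    by (auto simp: in_keys_iff)
  then show ?thesis
    by (subst (1 2) linear_nf_superset[of "Poly_Mapping.keys p"]) (auto simp: free.scale_sum_right)
qed

lemma tree_poly_induct [case_names zero single add]:
  fixes p :: "'e tree \<Rightarrow>\<^sub>0 'k::field"
  assumes "Q 0"
    and "\<And>t c. Q (Poly_Mapping.single t c)"
    and "\<And>p q. Q p \<Longrightarrow> Q q \<Longrightarrow> Q (p + q)"
  shows "Q p"
proof -
  have "p = (\<Sum>t\<in>Poly_Mapping.keys p. Poly_Mapping.single t (Poly_Mapping.lookup p t))"
    by (rule poly_mapping_eqI) (simp add: lookup_sum lookup_single when_def in_keys_iff)
  moreover have "Q (\<Sum>t\<in>A. Poly_Mapping.single t (Poly_Mapping.lookup p t))" if "finite A" for A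
    using that by induction (use assms in auto)
  ultimately show ?thesis
    by (metis finite_keys)
qed

text \<open>Together with its counterpart for the right argument, this makes the kernel of
  \<open>linear_nf\<close> closed under composition on either side.\<close>

lemma linear_nf_comp_left: "linear_nf (free_comp (linear_nf x) i y) = linear_nf (free_comp x i y)"
proof (induction x rule: tree_poly_induct)
  case (single s c)
  show ?case
    by (induction y rule: tree_poly_induct)
      (simp_all add: free_comp_add_right linear_nf_add nf_graft_nf_left)
qed (simp_all add: free_comp_add_left linear_nf_add)

lemma linear_nf_comp_right: "linear_nf (free_comp x i (linear_nf y)) = linear_nf (free_comp x i y)"
proof (induction x rule: tree_poly_induct)
  case (single s c)
  show ?case
    by (induction y rule: tree_poly_induct)
      (simp_all add: free_comp_add_right linear_nf_add nf_graft_nf_right)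
qed (simp_all add: free_comp_add_left linear_nf_add)

lemma as2_relators_altdef:
  "as2_relators = {Poly_Mapping.single (Node (Node Leaf (\<alpha>, \<beta>) Leaf) (\<alpha> * \<beta>, \<gamma>) Leaf) 1 -
     Poly_Mapping.single (Node Leaf (\<alpha>, \<beta> * \<gamma>) (Node Leaf (\<beta>, \<gamma>) Leaf)) 1 | \<alpha> \<beta> \<gamma>. True}"
  by (simp add: as2_relators_def free_gen_def)

text \<open>The two trees of a relator have the same normal form, and the kernel of
  \<open>linear_nf\<close> is an operadic ideal. This lets \<open>linear_nf\<close> descend to the
  quotient, where it yields independence.\<close>

lemma linear_nf_ideal: "x \<in> operad_ideal as2_relators \<Longrightarrow> linear_nf x = 0"
proof (induction rule: operad_ideal.induct)
  case (relator x)
  then show ?case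
    by (auto simp: as2_relators_altdef linear_nf_diff)
next
  case (comp_left x i y)
  then show ?case
    using linear_nf_comp_left[of x i y] by simp
next
  case (comp_right x y i)
  then show ?case
    using linear_nf_comp_right[of y i x] by simp
qed (simp_all add: linear_nf_add linear_nf_scale)

text \<open>Needed for spanning: every tree equals its normal form modulo the ideal.\<close>

lemma rewrites_diff_in_ideal:
  "s \<leadsto> t \<Longrightarrow> Poly_Mapping.single s (1::'k::field) - Poly_Mapping.single t 1 \<in> operad_ideal as2_relators"
proof (induction rule: rewrites_to.induct)
  case (rewrites_refl t)
  show ?case by (simp add: operad_ideal.zero)
next
  case (rewrites_rotate t \<alpha> \<beta> u \<gamma> v)
  let ?r = "Poly_Mapping.single (Node (Node Leaf (\<alpha>, \<beta>) Leaf) (\<alpha> * \<beta>, \<gamma>) Leaf) (1::'k) -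
     Poly_Mapping.single (Node Leaf (\<alpha>, \<beta> * \<gamma>) (Node Leaf (\<beta>, \<gamma>) Leaf)) 1"
  have "?r \<in> operad_ideal as2_relators"
    unfolding as2_relators_altdef by (rule operad_ideal.relator) blast
  \<comment> \<open>Grafting from right to left, at leaves 3, 2, 1, leaves the positions still to be
    filled unchanged.\<close>
  then have "free_comp (free_comp (free_comp ?r 3 (Poly_Mapping.single v 1))
      2 (Poly_Mapping.single u 1)) 1 (Poly_Mapping.single t 1) \<in> operad_ideal as2_relators"
    by (intro operad_ideal.comp_left)
  then show ?case
    by (simp add: free_comp_minus_left)
next
  case (rewrites_Node l l' r r' a)
  \<comment> \<open>The children are replaced one after the other, through the intermediate tree
    \<open>Node l' a r\<close>.\<close>
  have "free_comp (Poly_Mapping.single (Node Leaf a r) 1) 1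
      (Poly_Mapping.single l 1 - Poly_Mapping.single l' (1::'k)) \<in> operad_ideal as2_relators"
    by (intro operad_ideal.comp_right rewrites_Node)
  then have "Poly_Mapping.single (Node l a r) 1 - Poly_Mapping.single (Node l' a r) (1::'k)
      \<in> operad_ideal as2_relators"
    by (simp add: free_comp_minus_right)
  moreover have "free_comp (Poly_Mapping.single (Node l' a Leaf) 1) (size1 l' + 1)
      (Poly_Mapping.single r 1 - Poly_Mapping.single r' (1::'k)) \<in> operad_ideal as2_relators"
    by (intro operad_ideal.comp_right rewrites_Node)
  then have "Poly_Mapping.single (Node l' a r) 1 - Poly_Mapping.single (Node l' a r') (1::'k)
      \<in> operad_ideal as2_relators"
    by (simp add: free_comp_minus_right)
  ultimately show ?case
    using operad_ideal.add by fastforce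
next
  case (rewrites_trans s t u)
  then show ?case
    using operad_ideal.add[OF rewrites_trans.IH] by simp
qed

section \<open>Normal trees as a basis of each component\<close>

lift_definition as2_nf :: "('w::semigroup_mult, 'k::field) as2 \<Rightarrow> (('w \<times> 'w) tree \<Rightarrow>\<^sub>0 'k)"
  is linear_nf
  unfolding as2_rel_def by (metis eq_iff_diff_eq_0 linear_nf_diff linear_nf_ideal)

interpretation as2_nf: Vector_Spaces.linear as2_scale free_scale
    "as2_nf :: ('w::semigroup_mult, 'k::field) as2 \<Rightarrow> _"
  by unfold_locales (transfer; simp add: linear_nf_add linear_nf_scale)+

definition as2_tree :: "('w::semigroup_mult \<times> 'w) tree \<Rightarrow> ('w, 'k::field) as2" where
  "as2_tree t = abs_as2 (Poly_Mapping.single t 1)"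

lemma as2_nf_tree: "as2_nf (as2_tree t) = Poly_Mapping.single (nf t) 1"
  by (simp add: as2_tree_def as2_nf.abs_eq)

lemma as2_tree_nf: "as2_tree (nf t) = (as2_tree t :: ('w::semigroup_mult, 'k::field) as2)"
proof -
  have "as2_rel (Poly_Mapping.single t (1::'k)) (Poly_Mapping.single (nf t) 1)"
    unfolding as2_rel_def by (rule rewrites_diff_in_ideal[OF rewrites_nf])
  then show ?thesis
    by (simp add: as2_tree_def as2.abs_eq_iff[symmetric])
qed

abbreviation normal_trees :: "nat \<Rightarrow> ('w::semigroup_mult \<times> 'w) tree set" where
  "normal_trees n \<equiv> {t. normal t \<and> size t = n}"

text \<open>A tree with \<open>Suc n\<close> leaves has \<open>n\<close> inner nodes, and so has its
  normal form, which represents the same class.\<close>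

lemma as2_arity_subset_span:
  "as2_arity (Suc n) \<subseteq> as2.span (as2_tree ` normal_trees n :: ('w::semigroup_mult, 'k::field) as2 set)"
proof -
  have "abs_as2 p \<in> as2.span (as2_tree ` normal_trees n :: ('w, 'k) as2 set)"
    if "p \<in> free_arity (Suc n)" for p
    using that
  proof (induction rule: free_arity_induct)
    case zero
    show ?case
      using as2.span_zero by (simp add: zero_as2_def)
  next
    case (single t c)
    have "abs_as2 (Poly_Mapping.single t c) = as2_scale c (as2_tree (nf t) :: ('w, 'k) as2)"
      unfolding as2_tree_nf by (simp add: as2_tree_def as2_scale.abs_eq)
    moreover have "nf t \<in> normal_trees n"
      using single size1_nf[of t] by (simp add: normal_nf size1_size)
    ultimately show ?case
      by (simp add: as2.span_base as2.span_scale)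
  next
    case (add p q)
    then show ?case
      by (simp add: as2.span_add flip: plus_as2.abs_eq)
  qed
  then show ?thesis
    by (auto simp: as2_arity_def)
qed

lemma dim_as2_arity:
  assumes "finite (normal_trees n :: ('w::semigroup_mult \<times> 'w) tree set)"
  shows "as2.dim (as2_arity (Suc n) :: ('w, 'k::field) as2 set) =
    card (normal_trees n :: ('w \<times> 'w) tree set)"
proof -
  let ?T = "normal_trees n :: ('w \<times> 'w) tree set"
  let ?e = "as2_tree :: _ \<Rightarrow> ('w, 'k) as2"
  have inj: "inj_on ?e ?T"
  proof (rule inj_onI)
    fix s t assume st: "s \<in> ?T" "t \<in> ?T" and "?e s = ?e t"
    then have "Poly_Mapping.keys (as2_nf (?e s)) = Poly_Mapping.keys (as2_nf (?e t))"
      by simp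
    then show "s = t"
      using st by (simp add: as2_nf_tree nf_normal)
  qed
  have "as2.independent (?e ` ?T)"
  proof (rule as2.independent_if_scalars_zero)
    fix f x assume 0: "(\<Sum>x\<in>?e ` ?T. as2_scale (f x) x) = 0" and "x \<in> ?e ` ?T"
    then obtain s where s: "s \<in> ?T" "x = ?e s" by blast
    \<comment> \<open>\<open>as2_nf\<close> carries the classes of normal trees to distinct basis
      vectors of the free operad, where coefficients can be read off.\<close>
    have "0 = as2_nf (\<Sum>t\<in>?T. as2_scale (f (?e t)) (?e t))"
      using 0 inj by (simp add: sum.reindex as2_nf.zero)
    also have "\<dots> = (\<Sum>t\<in>?T. Poly_Mapping.single t (f (?e t)))"
      unfolding as2_nf.sum as2_nf.scale by (simp add: as2_nf_tree nf_normal)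
    finally have "0 = Poly_Mapping.lookup (\<Sum>t\<in>?T. Poly_Mapping.single t (f (?e t))) s"
      by simp
    also have "\<dots> = f x"
      using s assms by (simp add: lookup_sum lookup_single when_def)
    finally show "f x = 0" by simp
  qed (use assms in simp)
  moreover have "?e ` ?T \<subseteq> as2_arity (Suc n)"
    by (auto simp: as2_arity_def as2_tree_def size1_size intro!: imageI free_single_in_arity)
  ultimately show ?thesis
    using as2_arity_subset_span card_image[OF inj] by (intro as2.dim_unique) auto
qed

section \<open>Counting normal trees\<close>

lemma normal_trees_0: "normal_trees 0 = {Leaf}"
  by auto

text \<open>The admissible root labels depend on the left child, hence the dependent sum that
  chooses \<open>l\<close> before \<open>a\<close>; the right child is unconstrained.\<close>

lemma normal_trees_Suc:
  "normal_trees (Suc n) = (\<lambda>(l, a, r). Node l a r) `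
    (\<Union>i\<le>n. SIGMA l:normal_trees i. {a. left_irreducible l a} \<times> normal_trees (n - i))" (is "?L = ?R")
proof
  show "?L \<subseteq> ?R"
  proof
    fix t assume t: "t \<in> ?L"
    then obtain l a r where "t = Node l a r" by (cases t) auto
    with t show "t \<in> ?R"
      by (intro image_eqI[of _ _ "(l, a, r)"]) auto
  qed
qed auto

lemma finite_normal_trees: "finite (normal_trees n :: ('w::{finite, semigroup_mult} \<times> 'w) tree set)"
proof (induction n rule: less_induct)
  case (less n)
  then show ?case
    by (cases n) (auto simp: normal_trees_0 normal_trees_Suc simp del: normal.simps
        intro!: finite_imageI finite_SigmaI)
qed

text \<open>A left child labelled \<open>b\<close> forbids the single value
  \<open>fst b * snd b\<close> for the first component and leaves the second free.\<close>

lemma card_left_irreducible: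
  fixes l :: "('w::{finite, semigroup_mult} \<times> 'w) tree"
  shows "real (card {a. left_irreducible l a}) =
    (if l = Leaf then real CARD('w) ^ 2 else real CARD('w) * (real CARD('w) - 1))"
proof (cases l)
  case Leaf
  then show ?thesis by (simp add: card_prod power2_eq_square)
next
  case (Node l' b r)
  then have "{a. left_irreducible l a} = (- {fst b * snd b}) \<times> UNIV"
    by auto
  with Node show ?thesis
    by (simp add: card_cartesian_product Compl_eq_Diff_UNIV card_Diff_singleton of_nat_diff
        Suc_leI[OF zero_less_card_finite])
qed

text \<open>Writing \<open>w ^ 2 = w * (w - 1) + w\<close> treats a leaf as left child like any
  other tree; the excess \<open>w\<close> occurs only for \<open>i = 0\<close> and gives the linear
  term.\<close>

lemma card_normal_trees_Suc:
  fixes n :: nat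
  defines "a \<equiv> \<lambda>n. real (card (normal_trees n :: ('w::{finite, semigroup_mult} \<times> 'w) tree set))"
    and "w \<equiv> real CARD('w)"
  shows "a (Suc n) = w * a n + w * (w - 1) * (\<Sum>i\<le>n. a i * a (n - i))"
proof -
  let ?T = "normal_trees :: nat \<Rightarrow> ('w \<times> 'w) tree set"
  let ?S = "\<lambda>i. SIGMA l:?T i. {a. left_irreducible l a} \<times> ?T (n - i)"
  have a0: "a 0 = 1"
    unfolding a_def normal_trees_0 by simp
  have fin: "finite (?T i)" for i by (rule finite_normal_trees)
  have S: "real (card (?S i)) = w * (w - 1) * (a i * a (n - i)) + (if i = 0 then w * a n else 0)" for i
  proof -
    have "real (card (?S i)) = (\<Sum>l\<in>?T i. real (card {a. left_irreducible l a}) * a (n - i))"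
      using fin by (simp add: card_SigmaI card_cartesian_product a_def)
    also have "\<dots> = (\<Sum>l\<in>?T i. w * (w - 1) * a (n - i) + (if i = 0 then w * a n else 0))"
      by (intro sum.cong)
        (auto simp: card_left_irreducible w_def[symmetric] power2_eq_square algebra_simps)
    also have "\<dots> = a i * (w * (w - 1) * a (n - i) + (if i = 0 then w * a n else 0))"
      by (simp add: a_def)
    also have "\<dots> = w * (w - 1) * (a i * a (n - i)) + (if i = 0 then w * a n else 0)"
      using a0 by (simp add: algebra_simps)
    finally show ?thesis .
  qed
  have "a (Suc n) = real (card (\<Union>i\<le>n. ?S i))"
    unfolding a_def normal_trees_Suc by (subst card_image) (auto simp: inj_on_def)
  also have "\<dots> = (\<Sum>i\<le>n. real (card (?S i)))"
    using fin by (subst card_UN_disjoint) auto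
  also have "\<dots> = w * a n + w * (w - 1) * (\<Sum>i\<le>n. a i * a (n - i))"
    by (simp add: S sum.distrib sum_distrib_left)
  finally show ?thesis .
qed

section \<open>Coefficients of powers of a quadratic power series\<close>

text \<open>
  \<open>quad_coeff c d n r\<close> is the coefficient of \<open>X ^ n\<close> in \<open>A ^ r\<close>, where
  \<open>A = 1 + X (c A + d A\<^sup>2)\<close>, as given by Lagrange inversion for \<open>u = A - 1\<close>, which
  satisfies \<open>u = X (1 + u) ((c + d) + d u)\<close>. It is only meaningful for \<open>n > 0\<close>.
\<close>

definition quad_term :: "nat \<Rightarrow> nat \<Rightarrow> nat \<Rightarrow> real" where
  "quad_term n r k = real r / real n * real (n choose k) * real ((n + r - 1) choose (r + k))"

definition quad_coeff :: "real \<Rightarrow> real \<Rightarrow> nat \<Rightarrow> nat \<Rightarrow> real" where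
  "quad_coeff c d n r = (\<Sum>k\<le>n. quad_term n r k * (c + d) ^ (n - k) * d ^ k)"

text \<open>With real subtraction the identity also holds for \<open>k > n\<close>, where both
  binomials vanish, so its uses need no bound on \<open>k\<close>.\<close>

lemma binomial_absorb_real:
  "real (Suc k) * real (n choose Suc k) = (real n - real k) * real (n choose k)"
proof (cases "k \<le> n")
  case True
  have "Suc k * (n choose Suc k) = (n - k) * (n choose k)"
    by (metis binomial_absorb_comp binomial_absorption)
  then show ?thesis
    using True by (metis of_nat_diff of_nat_mult)
qed (simp add: binomial_eq_0)

lemma binomial_lower_real:
  "(real n + 1) * real (n choose k) = (real n + 1 - real k) * real (Suc n choose k)"
proof (cases "k \<le> Suc n")
  case True
  have "(Suc n - k) * (Suc n choose k) = Suc n * (n choose k)"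
    using binomial_absorb_comp[of "Suc n" k] by simp
  then show ?thesis
    using True by (metis of_nat_Suc of_nat_diff of_nat_mult add.commute)
qed (simp add: binomial_eq_0)

text \<open>Coefficient of \<open>d ^ Suc k\<close> in the recurrence \<open>quad_coeff_rec\<close>,
  read as a polynomial in \<open>x = c + d\<close> and \<open>d\<close>. Substituting
  \<open>c = x - d\<close> produces the last bracket, with the index lowered to
  \<open>k\<close>.\<close>

lemma quad_term_rec_Suc:
  "quad_term (m + 2) (r + 1) (Suc k) = quad_term (m + 2) r (Suc k) + quad_term (m + 1) (r + 1) (Suc k) +
    (quad_term (m + 1) (r + 2) k - quad_term (m + 1) (r + 1) k)"
proof -
  \<comment> \<open>All binomials reduce to \<open>B\<close> and two neighbours \<open>P\<close>,
    \<open>Q\<close> in one row of Pascal's triangle; \<open>PQ\<close> relates the latter.\<close>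
  define P where "P = real ((m + 1 + r) choose (r + k + 2))"
  define Q where "Q = real ((m + 1 + r) choose (r + k + 1))"
  define B where "B = real ((m + 2) choose Suc k)"
  have PQ: "(real r + real k + 2) * P = (real m - real k) * Q"
    using binomial_absorb_real[of "r + k + 1" "m + 1 + r"] by (simp add: P_def Q_def algebra_simps)
  have sum: "real ((m + 2 + r) choose (r + k + 2)) = P + Q"
    by (simp add: P_def Q_def)
  have B1: "real ((m + 1) choose Suc k) = (real m + 1 - real k) * B / (real m + 2)"
    using binomial_lower_real[of "m + 1" "Suc k"] by (simp add: B_def field_simps)
  have B2: "real ((m + 1) choose k) = (real k + 1) * B / (real m + 2)"
    using Suc_times_binomial_eq[of "m + 1" k, THEN arg_cong[of _ _ real]]
    by (simp add: B_def field_simps)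
  have "quad_term (m + 2) (r + 1) (Suc k) = (real r + 1) / (real m + 2) * B * (P + Q)"
    using sum by (simp add: quad_term_def B_def add_ac)
  moreover have "quad_term (m + 2) r (Suc k) = real r / (real m + 2) * B * Q"
    by (simp add: quad_term_def B_def Q_def add_ac)
  moreover have "quad_term (m + 1) (r + 1) (Suc k) =
      (real r + 1) / (real m + 1) * ((real m + 1 - real k) * B / (real m + 2)) * P"
    using B1 by (simp add: quad_term_def P_def add_ac)
  moreover have "quad_term (m + 1) (r + 2) k =
      (real r + 2) / (real m + 1) * ((real k + 1) * B / (real m + 2)) * (P + Q)"
    using B2 sum by (simp add: quad_term_def add_ac)
  moreover have "quad_term (m + 1) (r + 1) k =
      (real r + 1) / (real m + 1) * ((real k + 1) * B / (real m + 2)) * Q"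
    using B2 by (simp add: quad_term_def Q_def add_ac)
  moreover have "(real r + 1) / (real m + 2) * B * (P + Q) = real r / (real m + 2) * B * Q +
      (real r + 1) / (real m + 1) * ((real m + 1 - real k) * B / (real m + 2)) * P +
      ((real r + 2) / (real m + 1) * ((real k + 1) * B / (real m + 2)) * (P + Q) -
       (real r + 1) / (real m + 1) * ((real k + 1) * B / (real m + 2)) * Q)"
  proof -
    \<comment> \<open>The difference of the two sides is a multiple of the difference of the two
      sides of \<open>PQ\<close>.\<close>
    have factor: "(r + 1) / y * B * (P + Q) - (r / y * B * Q + (r + 1) / x * (z * B / y) * P +
        ((r + 2) / x * (w * B / y) * (P + Q) - (r + 1) / x * (w * B / y) * Q)) =
      B / (x * y) * (x * ((r + 1) * P + Q) - (r + 1) * z * P - w * ((r + 2) * P + Q))"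
      if "x \<noteq> 0" "y \<noteq> 0" for x y z w r :: real
      using that by (simp add: divide_simps) (simp add: algebra_simps)
    have "(real m + 1) * ((real r + 1) * P + Q) - (real r + 1) * (real m + 1 - real k) * P -
        (real k + 1) * ((real r + 2) * P + Q) = (real m - real k) * Q - (real r + real k + 2) * P"
      by (simp add: algebra_simps)
    then show ?thesis
      using PQ factor[of "real m + 1" "real m + 2" "real r" "real m + 1 - real k" "real k + 1"] by simp
  qed
  ultimately show ?thesis
    by simp
qed

lemma quad_term_rec_0:
  "quad_term (m + 2) (r + 1) 0 = quad_term (m + 2) r 0 + quad_term (m + 1) (r + 1) 0"
proof -
  define P where "P = real ((m + 1 + r) choose (r + 1))"
  define Q where "Q = real ((m + 1 + r) choose r)"
  have PQ: "(real r + 1) * P = (real m + 1) * Q"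
    using binomial_absorb_real[of r "m + 1 + r"] by (simp add: P_def Q_def algebra_simps)
  have sum: "real ((m + 2 + r) choose (r + 1)) = P + Q"
    by (simp add: P_def Q_def)
  have "quad_term (m + 2) (r + 1) 0 = (real r + 1) / (real m + 2) * (P + Q)"
    using sum by (simp add: quad_term_def add_ac)
  moreover have "quad_term (m + 2) r 0 = real r / (real m + 2) * Q"
    by (simp add: quad_term_def Q_def add_ac)
  moreover have "quad_term (m + 1) (r + 1) 0 = (real r + 1) / (real m + 1) * P"
    by (simp add: quad_term_def P_def add_ac)
  moreover have "(real r + 1) * (P + Q) / (real m + 2) - (real r * Q / (real m + 2) +
      (real r + 1) * P / (real m + 1)) =
      ((real m + 1) * Q - (real r + 1) * P) / ((real m + 1) * (real m + 2))"
    by (simp add: divide_simps) (simp add: algebra_simps)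
  ultimately show ?thesis
    using PQ by simp
qed

text \<open>Mirrors the coefficient of \<open>X ^ (m + 2)\<close> in
  \<open>A ^ (r + 1) = A ^ r + X (c A ^ (r + 1) + d A ^ (r + 2))\<close>.\<close>

lemma quad_coeff_rec:
  "quad_coeff c d (m + 2) (r + 1) =
    quad_coeff c d (m + 2) r + c * quad_coeff c d (m + 1) (r + 1) + d * quad_coeff c d (m + 1) (r + 2)"
proof -
  let ?q = quad_term and ?x = "c + d"
  let ?p = "\<lambda>k. ?x ^ (m + 2 - k) * d ^ k"
  have x: "?x * quad_coeff c d (m + 1) s = (\<Sum>k\<le>m + 2. ?q (m + 1) s k * ?p k)" for s
  proof -
    \<comment> \<open>The added term \<open>k = m + 2\<close> vanishes because
      \<open>(m + 1) choose (m + 2)\<close> is 0.\<close>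
    have "(\<Sum>k\<le>m + 2. ?q (m + 1) s k * ?p k) = (\<Sum>k\<le>m + 1. ?q (m + 1) s k * ?p k)"
      by (simp add: quad_term_def)
    also have "\<dots> = (\<Sum>k\<le>m + 1. ?x * (?q (m + 1) s k * ?x ^ (m + 1 - k) * d ^ k))"
      by (intro sum.cong) (simp_all add: Suc_diff_le)
    finally show ?thesis
      by (simp only: quad_coeff_def sum_distrib_left)
  qed
  have d: "d * quad_coeff c d (m + 1) s = (\<Sum>k\<le>m + 1. ?q (m + 1) s k * ?p (Suc k))" for s
    by (simp add: quad_coeff_def sum_distrib_left mult_ac del: sum.atMost_Suc)
  have shift: "(\<Sum>k\<le>m + 2. f k * ?p k) = f 0 * ?p 0 + (\<Sum>k\<le>m + 1. f (Suc k) * ?p (Suc k))" for f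
    using sum.atMost_Suc_shift[of "\<lambda>k. f k * ?p k" "m + 1"] by (simp del: sum.atMost_Suc)
  have "quad_coeff c d (m + 2) s = (\<Sum>k\<le>m + 2. ?q (m + 2) s k * ?p k)" for s
    by (simp add: quad_coeff_def mult.assoc)
  note top = this[unfolded shift]
  have "quad_coeff c d (m + 2) (r + 1) = quad_coeff c d (m + 2) r +
      ?x * quad_coeff c d (m + 1) (r + 1) +
      (d * quad_coeff c d (m + 1) (r + 2) - d * quad_coeff c d (m + 1) (r + 1))"
    unfolding top x d shift quad_term_rec_Suc quad_term_rec_0
    by (simp only: sum.distrib sum_subtractf distrib_right left_diff_distrib add_ac)
  then show ?thesis
    by (simp add: algebra_simps)
qed

text \<open>Both sides obey the same recurrence. The induction on the degree is outermost because
  the recurrence calls for the higher power \<open>r + 2\<close> in the lower degree.\<close>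

lemma fps_quadratic_power_nth:
  fixes A :: "real fps"
  assumes A: "A = 1 + fps_X * (fps_const c * A + fps_const d * A ^ 2)"
  shows "fps_nth (A ^ r) (Suc n) = quad_coeff c d (Suc n) r"
proof -
  have nth_0: "fps_nth (A ^ r) 0 = 1" for r
    by (subst A) (simp add: fps_nth_power_0)
  have "A ^ Suc r = A ^ r + fps_X * (fps_const c * A ^ Suc r + fps_const d * A ^ (r + 2))" for r
  proof -
    have "A ^ Suc r = A ^ r * A"
      by simp
    also have "\<dots> = A ^ r * (1 + fps_X * (fps_const c * A + fps_const d * A ^ 2))"
      by (rule arg_cong[where f = "(*) (A ^ r)", OF A])
    also have "\<dots> = A ^ r + fps_X * (fps_const c * A ^ Suc r + fps_const d * A ^ (r + 2))"
      by (simp add: algebra_simps power2_eq_square)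
    finally show ?thesis .
  qed
  then have rec: "fps_nth (A ^ Suc r) (Suc n) =
      fps_nth (A ^ r) (Suc n) + (c * fps_nth (A ^ Suc r) n + d * fps_nth (A ^ (r + 2)) n)" for r n
    by (metis fps_X_mult_nth fps_add_nth fps_mult_left_const_nth nat.simps(3) diff_Suc_1)
  \<comment> \<open>At index 0 \<open>quad_coeff\<close> is 0 by division by zero, whereas
    \<open>A ^ r\<close> has constant term 1; the induction therefore starts in degree 1.\<close>
  have quad_1: "quad_coeff c d (Suc 0) r = real r * (c + d)" for r
    by (simp add: quad_coeff_def quad_term_def binomial_eq_0)
  show ?thesis
  proof (induction n arbitrary: r)
    case 0
    show ?case
    proof (induction r)
      case (Suc r)
      then show ?case
        using rec[of r 0] by (simp add: nth_0 quad_1 algebra_simps del: power_Suc)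
    qed (simp add: quad_1)
  next
    case (Suc n)
    note IH = this
    show ?case
    proof (induction r)
      case (Suc r)
      then show ?case
        using rec[of r "Suc n"] IH[of "Suc r"] IH[of "r + 2"] quad_coeff_rec[of c d n r]
        by simp
    qed (simp add: quad_coeff_def quad_term_def)
  qed
qed

section \<open>The dimension formula\<close>

lemma card_normal_trees:
  fixes n :: nat
  defines "w \<equiv> real CARD('w)"
  shows "real (card (normal_trees (Suc n) :: ('w::{finite, semigroup_mult} \<times> 'w) tree set)) =
    quad_coeff w (w * (w - 1)) (Suc n) 1"
proof -
  define a where "a n = real (card (normal_trees n :: ('w \<times> 'w) tree set))" for n
  have 0: "a 0 = 1"
    unfolding a_def normal_trees_0 by simp
  have Suc: "a (Suc n) = w * a n + w * (w - 1) * (\<Sum>i\<le>n. a i * a (n - i))" for n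
    unfolding a_def w_def by (rule card_normal_trees_Suc)
  have square: "fps_nth (Abs_fps a ^ 2) n = (\<Sum>i\<le>n. a i * a (n - i))" for n
    by (simp add: power2_eq_square fps_mult_nth atLeast0AtMost)
  have "Abs_fps a = 1 + fps_X * (fps_const w * Abs_fps a + fps_const (w * (w - 1)) * Abs_fps a ^ 2)"
  proof (rule fps_ext)
    fix m show "fps_nth (Abs_fps a) m = fps_nth (1 + fps_X * (fps_const w * Abs_fps a +
        fps_const (w * (w - 1)) * Abs_fps a ^ 2)) m"
      by (cases m) (simp_all add: 0 Suc square del: fps_const_mult fps_const_sub)
  qed
  from fps_quadratic_power_nth[OF this, of 1 n] show ?thesis
    by (simp add: a_def)
qed

theorem corollary1p5:
  fixes n :: nat and \<omega> :: real and p :: "nat \<Rightarrow> nat"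
  assumes \<omega>: "\<omega> = real CARD('w::{finite, semigroup_mult})"
    and p: "\<And>m. p m = as2.dim (as2_arity m :: ('w, 'k::field) as2 set)"
    and n: "n \<ge> 2"
  shows "real (p n) = \<omega> ^ n / (real n - 1) *
    (\<Sum>k = 1..n - 1. real ((n - 1) choose k) * real ((n - 1) choose (k - 1)) *
      \<omega> ^ (n - 1 - k) * (\<omega> - 1) ^ (k - 1))"
proof -
  \<comment> \<open>Arity \<open>m + 2\<close> corresponds to trees with \<open>Suc m\<close> inner
    nodes.\<close>
  obtain m where m: "n = m + 2"
    using n by (metis add.commute le_Suc_ex)
  have "real (p n) = quad_coeff \<omega> (\<omega> * (\<omega> - 1)) (Suc m) 1"
    using card_normal_trees[where 'w = 'w, of m] finite_normal_trees[where 'w = 'w, of "Suc m"]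
    by (simp add: p m dim_as2_arity \<omega> del: normal.simps)
  also have "\<dots> = (\<Sum>k\<le>m. quad_term (Suc m) 1 k * (\<omega> + \<omega> * (\<omega> - 1)) ^ (Suc m - k) * (\<omega> * (\<omega> - 1)) ^ k)"
    by (simp add: quad_coeff_def quad_term_def binomial_eq_0)
  also have "\<dots> = (\<Sum>k\<le>m. \<omega> ^ n / (real n - 1) * (real ((n - 1) choose Suc k) * real ((n - 1) choose k) *
      \<omega> ^ (m - k) * (\<omega> - 1) ^ k))"
  proof (rule sum.cong)
    fix k assume "k \<in> {..m}"
    then obtain j where j: "m = k + j" by (auto simp: le_iff_add)
    define v where "v = \<omega> - 1"
    \<comment> \<open>Here \<open>c + d\<close> is \<omega> squared, so the total exponent of
      \<omega> is \<open>2 * (m + 1 - k) + k = n + (m - k)\<close>.\<close>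
    have "\<omega> + \<omega> * v = \<omega> ^ 2"
      by (simp add: v_def power2_eq_square algebra_simps)
    then show "quad_term (Suc m) 1 k * (\<omega> + \<omega> * (\<omega> - 1)) ^ (Suc m - k) * (\<omega> * (\<omega> - 1)) ^ k =
      \<omega> ^ n / (real n - 1) * (real ((n - 1) choose Suc k) * real ((n - 1) choose k) *
      \<omega> ^ (m - k) * (\<omega> - 1) ^ k)"
      unfolding v_def[symmetric]
      by (simp add: quad_term_def m j power_add power_mult power_mult_distrib power2_eq_square
          field_simps del: binomial_Suc_Suc)
  qed simp
  \<comment> \<open>Shift of the index by one. For \<omega> = 1 only the term \<open>k = 1\<close>
    of the new sum survives, through \<open>0 ^ 0 = 1\<close>.\<close>
  also have "\<dots> = \<omega> ^ n / (real n - 1) *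
    (\<Sum>k = 1..n - 1. real ((n - 1) choose k) * real ((n - 1) choose (k - 1)) *
      \<omega> ^ (n - 1 - k) * (\<omega> - 1) ^ (k - 1))"
    unfolding sum_distrib_left[symmetric]
    by (intro arg_cong[where f = "(*) _"] sum.reindex_bij_witness[of _ "\<lambda>k. k - 1" Suc])
      (auto simp: m)
  finally show ?thesis .
qed

end
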